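(* For $n\ge 0$ and $t\ge 0$ let $f(n,1,t)$ denote the number of permutations $\pi\in S_n$ such that $G_\pi$ has exactly $t$ dominating sets of size one (so $f(n,1,0)=n!-g(n,1)$, where $g(n,1)$ is the number of $\pi\in S_n$ with $\gamma(G_\pi)=1$). Then for $n\ge1$ and $1\le t\le n$, \[ f(n,1,t)=\sum_{k=1}^{n-t+1} f(n-k,1,t-1)\,f(k-1,1,0). \]
   Context: For a permutation $\pi$ of $[n]=\{1,\dots,n\}$ (one-line notation $[\pi(1),\dots,\pi(n)]$), the permutation graph $G_\pi$ has vertex set $[n]$ and an edge between $i<j$ iff $\pi^{-1}(i)>\pi^{-1}(j)$. A set $D$ of vertices dominates a graph $G$ if every vertex is in $D$ or adjacent to a vertex of $D$; $\gamma(G)$ is the minimum size of a dominating set. Counts of "permutation graphs on $n$ vertices" with a property are counts of permutations $\pi\in S_n$ whose graph has the property. By convention $0!=1$ and $g(0,1)=0$, so $f(0,1,0)=1$. *)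

theory Defs
  imports "HOL-Combinatorics.Permutations"
begin

text \<open>A simple graph is given by its vertex set and its set of two-element edges.\<close>

definition dominating_set :: "'a set \<Rightarrow> 'a set set \<Rightarrow> 'a set \<Rightarrow> bool" where
  "dominating_set V E D \<longleftrightarrow> D \<subseteq> V \<and> (\<forall>v\<in>V. v \<in> D \<or> (\<exists>u\<in>D. {u, v} \<in> E))"

definition domination_number :: "'a set \<Rightarrow> 'a set set \<Rightarrow> nat" where
  "domination_number V E = (LEAST m. \<exists>D. dominating_set V E D \<and> card D = m)"

definition perm_vertices :: "nat \<Rightarrow> nat set" where
  "perm_vertices n = {1..n}"

definition perm_edges :: "nat \<Rightarrow> (nat \<Rightarrow> nat) \<Rightarrow> nat set set" where
  "perm_edges n \<pi> = {{i, j} | i j. i \<in> perm_vertices n \<and> j \<in> perm_vertices n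
                                   \<and> i < j \<and> inv \<pi> i > inv \<pi> j}"

text \<open>\<open>g_count n m\<close> counts the permutations whose graph has domination number \<open>m\<close>;
  \<open>f_count n m t\<close> counts those whose graph has exactly \<open>t\<close> dominating sets of size \<open>m\<close>,
  whether or not \<open>m\<close> is the domination number.\<close>

definition g_count :: "nat \<Rightarrow> nat \<Rightarrow> nat" where
  "g_count n m = card {\<pi>. \<pi> permutes {1..n} \<and>
                    domination_number (perm_vertices n) (perm_edges n \<pi>) = m}"

definition f_count :: "nat \<Rightarrow> nat \<Rightarrow> nat \<Rightarrow> nat" where
  "f_count n m t = card {\<pi>. \<pi> permutes {1..n} \<and>
                      card {D. dominating_set (perm_vertices n) (perm_edges n \<pi>) D \<and> card D = m} = t}"

lemma domination_number_eq_1_iff: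
  assumes "finite V"
  shows "domination_number V E = 1 \<longleftrightarrow> card {D. dominating_set V E D \<and> card D = 1} \<noteq> 0"
proof -
  let ?P = "\<lambda>m. \<exists>D. dominating_set V E D \<and> card D = m"
  have "finite {D. dominating_set V E D \<and> card D = 1}"
    by (rule finite_subset[of _ "Pow V"]) (use assms in \<open>auto simp: dominating_set_def\<close>)
  then have *: "card {D. dominating_set V E D \<and> card D = 1} \<noteq> 0 \<longleftrightarrow> ?P 1"
    by auto
  have "?P (card V)"
    by (rule exI[of _ V]) (auto simp: dominating_set_def)
  then have least: "?P (LEAST m. ?P m)"
    by (rule LeastI)
  have "\<not> ?P 0" if "?P 1"
  proof
    assume "?P 0"
    then obtain D where D: "dominating_set V E D" "card D = 0" by blast
    with assms have "D = {}"
      by (metis card_0_eq dominating_set_def finite_subset)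
    with D have "V = {}" by (auto simp: dominating_set_def)
    with that show False by (auto simp: dominating_set_def)
  qed
  then have "(LEAST m. ?P m) = 1" if "?P 1"
    using that least Least_le[of ?P 1] by (metis One_nat_def le_SucE le_zero_eq)
  with least * show ?thesis
    unfolding domination_number_def by metis
qed

lemma f_count_1_0_plus_g_count: "f_count n 1 0 + g_count n 1 = fact n"
proof -
  let ?c = "\<lambda>\<pi>. card {D. dominating_set (perm_vertices n) (perm_edges n \<pi>) D \<and> card D = 1}"
  let ?S = "{\<pi>. \<pi> permutes {1..n}}"
  have fin: "finite ?S" by (simp add: finite_permutations)
  have g: "g_count n 1 = card {\<pi>\<in>?S. ?c \<pi> \<noteq> 0}"
    unfolding g_count_def using domination_number_eq_1_iff[of "perm_vertices n"]
    by (simp only: perm_vertices_def finite_atLeastAtMost mem_Collect_eq)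
  have f: "f_count n 1 0 = card {\<pi>\<in>?S. ?c \<pi> = 0}"
    by (simp add: f_count_def)
  have "f_count n 1 0 + g_count n 1 = card ({\<pi>\<in>?S. ?c \<pi> = 0} \<union> {\<pi>\<in>?S. ?c \<pi> \<noteq> 0})"
    unfolding f g by (rule card_Un_disjoint[symmetric]) (use fin in auto)
  also have "{\<pi>\<in>?S. ?c \<pi> = 0} \<union> {\<pi>\<in>?S. ?c \<pi> \<noteq> 0} = ?S" by blast
  also have "card ?S = fact n" by (simp add: card_permutations)
  finally show ?thesis .
qed

lemma f_count_1_0_eq: "f_count n 1 0 = fact n - g_count n 1"
  using f_count_1_0_plus_g_count[of n] by linarith

lemma g_count_0_1: "g_count 0 1 = 0"
proof -
  have "{D. dominating_set (perm_vertices 0) E D \<and> card D = 1} = {}" for E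
    by (auto simp: dominating_set_def perm_vertices_def)
  then have "domination_number (perm_vertices 0) E \<noteq> 1" for E
    using domination_number_eq_1_iff[of "perm_vertices 0" E]
    by (simp only: perm_vertices_def finite_atLeastAtMost card.empty)
  then show ?thesis by (simp add: g_count_def)
qed

lemma f_count_0_1_0: "f_count 0 1 0 = 1"
  by (simp only: f_count_1_0_eq g_count_0_1) simp

end

theory Submission
  imports Defs
begin

text \<open>A vertex \<open>v\<close> dominates \<open>G\<^sub>\<pi>\<close> iff \<open>\<pi>\<close> lists all larger values before \<open>v\<close> and all smaller
  ones after it. Composing \<open>\<pi>\<inverse>\<close> with the reversal of positions turns such vertices into strong
  points of a permutation \<open>\<tau>\<close>: those \<open>v\<close> with \<open>\<tau> u < \<tau> v\<close> for all \<open>u < v\<close> and \<open>\<tau> u > \<tau> v\<close> for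
  all \<open>u > v\<close>. A strong point \<open>k\<close> is fixed by \<open>\<tau>\<close> and splits \<open>\<tau>\<close> into a permutation of
  \<open>{1..<k}\<close> and one of \<open>{k<..n}\<close>; if \<open>k\<close> is the least of \<open>t\<close> strong points, the first part has
  none and the second has \<open>t - 1\<close>.\<close>

definition strong_points :: "nat set \<Rightarrow> (nat \<Rightarrow> nat) \<Rightarrow> nat set" where
  "strong_points X \<tau> = {v \<in> X. \<forall>u\<in>X. (u < v \<longrightarrow> \<tau> u < \<tau> v) \<and> (v < u \<longrightarrow> \<tau> v < \<tau> u)}"

text \<open>The ground set is arbitrary so that the two sides \<open>{1..<k}\<close> and
  \<open>{k<..n}\<close> of a strong point \<open>k\<close> can be treated like
  \<open>{1..n}\<close> itself.\<close>

definition strong_perms :: "nat set \<Rightarrow> nat \<Rightarrow> (nat \<Rightarrow> nat) set" where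
  "strong_perms X t = {\<tau>. \<tau> permutes X \<and> card (strong_points X \<tau>) = t}"

text \<open>Being the identity outside \<open>{1..n}\<close> makes the reversal a permutation in the
  sense of \<open>permutes\<close>.\<close>

definition rev_upto :: "nat \<Rightarrow> nat \<Rightarrow> nat" where
  "rev_upto n x = (if x \<in> {1..n} then n + 1 - x else x)"

lemma strong_points_subset: "strong_points X \<tau> \<subseteq> X"
  by (auto simp: strong_points_def)

lemma rev_upto_rev_upto [simp]: "rev_upto n (rev_upto n x) = x"
  by (auto simp: rev_upto_def)

lemma rev_upto_permutes: "rev_upto n permutes {1..n}"
  by (rule bij_imp_permutes, rule bij_betw_byWitness[where f' = "rev_upto n"]) (auto simp: rev_upto_def)

lemma rev_upto_less_iff:
  assumes "x \<in> {1..n}" "y \<in> {1..n}"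
  shows "rev_upto n x < rev_upto n y \<longleftrightarrow> y < x"
  using assms by (auto simp: rev_upto_def)

section \<open>Dominating vertices as strong points\<close>

lemma perm_edges_iff:
  assumes "u < v"
  shows "{u, v} \<in> perm_edges n \<pi> \<longleftrightarrow> u \<in> {1..n} \<and> v \<in> {1..n} \<and> inv \<pi> v < inv \<pi> u"
  using assms by (fastforce simp: perm_edges_def perm_vertices_def doubleton_eq_iff)

text \<open>Edges are the inversions of \<open>inv \<pi>\<close>. Reversing the positions turns
  inversions into non-inversions, so adjacency of \<open>v\<close> to every other vertex becomes the
  order condition of a strong point.\<close>

lemma dominating_singleton_iff:
  assumes "\<pi> permutes {1..n}"
  shows "dominating_set (perm_vertices n) (perm_edges n \<pi>) {v}
    \<longleftrightarrow> v \<in> strong_points {1..n} (rev_upto n \<circ> inv \<pi>)"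
proof -
  have mem: "inv \<pi> u \<in> {1..n}" if "u \<in> {1..n}" for u
    using that permutes_in_image[OF permutes_inv[OF assms]] by simp
  have "(u = v \<or> {v, u} \<in> perm_edges n \<pi>) \<longleftrightarrow>
      (u < v \<longrightarrow> rev_upto n (inv \<pi> u) < rev_upto n (inv \<pi> v)) \<and>
      (v < u \<longrightarrow> rev_upto n (inv \<pi> v) < rev_upto n (inv \<pi> u))"
    if "v \<in> {1..n}" "u \<in> {1..n}" for u
    using that perm_edges_iff[of u v n \<pi>] perm_edges_iff[of v u n \<pi>]
      rev_upto_less_iff[OF mem mem, of u v] rev_upto_less_iff[OF mem mem, of v u]
    by (cases u v rule: linorder_cases) (auto simp: insert_commute)
  then have "(\<forall>u\<in>{1..n}. u = v \<or> {v, u} \<in> perm_edges n \<pi>) \<longleftrightarrow>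
      (\<forall>u\<in>{1..n}. (u < v \<longrightarrow> rev_upto n (inv \<pi> u) < rev_upto n (inv \<pi> v)) \<and>
        (v < u \<longrightarrow> rev_upto n (inv \<pi> v) < rev_upto n (inv \<pi> u)))"
    if "v \<in> {1..n}"
    using that by (intro ball_cong refl)
  then show ?thesis
    by (simp add: dominating_set_def strong_points_def perm_vertices_def cong: conj_cong)
qed

text \<open>Dominating sets of size one correspond to strong points through \<open>v\<close> and
  \<open>{v}\<close>, and passing from \<open>\<pi>\<close> to
  \<open>rev_upto n \<circ> inv \<pi>\<close> is a bijection on the permutations of
  \<open>{1..n}\<close>.\<close>

lemma f_count_1_eq: "f_count n 1 t = card (strong_perms {1..n} t)"
proof -
  have dom: "card {D. dominating_set (perm_vertices n) (perm_edges n \<pi>) D \<and> card D = 1}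
      = card (strong_points {1..n} (rev_upto n \<circ> inv \<pi>))" if "\<pi> permutes {1..n}" for \<pi>
  proof -
    have "{D. dominating_set (perm_vertices n) (perm_edges n \<pi>) D \<and> card D = 1}
        = (\<lambda>v. {v}) ` strong_points {1..n} (rev_upto n \<circ> inv \<pi>)"
      using dominating_singleton_iff[OF that] by (auto simp: card_1_singleton_iff image_iff)
    then show ?thesis by (simp add: card_image)
  qed
  have "bij_betw (\<lambda>\<pi>. rev_upto n \<circ> inv \<pi>)
      {\<pi>. \<pi> permutes {1..n} \<and>
        card {D. dominating_set (perm_vertices n) (perm_edges n \<pi>) D \<and> card D = 1} = t}
      (strong_perms {1..n} t)"
  \<comment> \<open>The witness solves \<open>\<tau> = rev_upto n \<circ> inv \<pi>\<close> for
    \<open>\<pi>\<close>, using that the reversal is an involution.\<close>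
  proof (rule bij_betw_byWitness[where f' = "\<lambda>\<tau>. inv (rev_upto n \<circ> \<tau>)"], goal_cases)
    case 1
    then show ?case by (auto simp: o_def permutes_inv_inv)
  next
    case 2
    have "inv (inv (rev_upto n \<circ> \<tau>)) = rev_upto n \<circ> \<tau>" if "\<tau> permutes {1..n}" for \<tau>
      using permutes_inv_inv permutes_compose[OF that rev_upto_permutes] by blast
    then show ?case by (auto simp: strong_perms_def o_def)
  next
    case 3
    show ?case
    proof (rule image_subsetI, unfold strong_perms_def mem_Collect_eq, elim conjE, intro conjI)
      fix \<pi>
      assume \<pi>: "\<pi> permutes {1..n}"
        "card {D. dominating_set (perm_vertices n) (perm_edges n \<pi>) D \<and> card D = 1} = t"
      show "rev_upto n \<circ> inv \<pi> permutes {1..n}"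
        by (rule permutes_compose[OF permutes_inv[OF \<pi>(1)] rev_upto_permutes])
      show "card (strong_points {1..n} (rev_upto n \<circ> inv \<pi>)) = t"
        using dom[OF \<pi>(1)] \<pi>(2) by simp
    qed
  next
    case 4
    show ?case
    proof (rule image_subsetI)
      fix \<tau> assume "\<tau> \<in> strong_perms {1..n} t"
      then have \<tau>: "\<tau> permutes {1..n}" "card (strong_points {1..n} \<tau>) = t"
        by (auto simp: strong_perms_def)
      have p: "rev_upto n \<circ> \<tau> permutes {1..n}"
        by (rule permutes_compose[OF \<tau>(1) rev_upto_permutes])
      have "rev_upto n \<circ> inv (inv (rev_upto n \<circ> \<tau>)) = \<tau>"
        using permutes_inv_inv[OF p] by (simp add: o_def)
      then show "inv (rev_upto n \<circ> \<tau>) \<in> {\<pi>. \<pi> permutes {1..n} \<and>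
          card {D. dominating_set (perm_vertices n) (perm_edges n \<pi>) D \<and> card D = 1} = t}"
        using dom[OF permutes_inv[OF p]] permutes_inv[OF p] \<tau>(2) by simp
    qed
  qed
  then show ?thesis
    unfolding f_count_def by (rule bij_betw_same_card)
qed

section \<open>Invariance under order isomorphisms\<close>

lemma card_strong_perms_order_iso:
  assumes h: "bij_betw h X Y" and mono: "strict_mono_on X h"
  shows "card (strong_perms X t) = card (strong_perms Y t)"
proof -
  \<comment> \<open>Conjugation by \<open>h\<close>, extended by the identity outside
    \<open>Y\<close>. Strong points depend only on order comparisons, which \<open>h\<close>
    preserves and reflects, so \<open>h\<close> carries those of \<open>\<tau>\<close> onto those of
    \<open>c \<tau>\<close>.\<close>
  define c where "c \<tau> = (\<lambda>y. if y \<in> Y then h (\<tau> (inv_into X h y)) else y)" for \<tau>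
  have c_h: "c \<tau> (h x) = h (\<tau> x)" if "x \<in> X" for \<tau> x
    using h that by (auto simp: c_def bij_betw_def)
  have less: "h x < h y \<longleftrightarrow> x < y" if "x \<in> X" "y \<in> X" for x y
    using mono that by (simp add: strict_mono_on_less)
  have strong: "strong_points Y (c \<tau>) = h ` strong_points X \<tau>" if "\<tau> permutes X" for \<tau>
  proof -
    have Y: "Y = h ` X" using h by (auto simp: bij_betw_def)
    show ?thesis
      unfolding Y strong_points_def
      using permutes_in_image[OF that] by (auto simp: c_h less)
  qed
  have card: "card (strong_points Y (c \<tau>)) = card (strong_points X \<tau>)" if "\<tau> permutes X" for \<tau>
    unfolding strong[OF that]
    by (rule card_image) (metis h bij_betw_def inj_on_subset strong_points_subset)
  have bij: "bij_betw c {\<tau>. \<tau> permutes X} {\<tau>. \<tau> permutes Y}"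
    using bij_betw_permutations[OF h] by (simp add: c_def[abs_def])
  have sub: "strong_perms X t \<subseteq> {\<tau>. \<tau> permutes X}"
    by (auto simp: strong_perms_def)
  have "strong_perms Y t = {\<sigma> \<in> c ` {\<tau>. \<tau> permutes X}. card (strong_points Y \<sigma>) = t}"
    unfolding bij_betw_imp_surj_on[OF bij] by (simp add: strong_perms_def)
  also have "\<dots> = c ` strong_perms X t"
    using card by (auto simp: strong_perms_def)
  finally have "bij_betw c (strong_perms X t) (strong_perms Y t)"
    using bij_betw_subset[OF bij sub] by simp
  then show ?thesis
    by (rule bij_betw_same_card)
qed

section \<open>Splitting a permutation at a strong point\<close>

lemma strong_points_cong:
  assumes "\<And>x. x \<in> X \<Longrightarrow> \<sigma> x = \<tau> x"
  shows "strong_points X \<sigma> = strong_points X \<tau>"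
  using assms by (auto simp: strong_points_def)

text \<open>All comparisons between a point of \<open>X\<close> and a point of \<open>Y\<close> hold
  by assumption, so only those within each block remain to be tested.\<close>

lemma strong_points_Un:
  assumes "\<And>x y. x \<in> X \<Longrightarrow> y \<in> Y \<Longrightarrow> x < y \<and> \<tau> x < \<tau> y"
  shows "strong_points (X \<union> Y) \<tau> = strong_points X \<tau> \<union> strong_points Y \<tau>"
  unfolding strong_points_def using assms by (blast dest: less_asym)

text \<open>The composition maps each of the blocks \<open>{1..<k}\<close>, \<open>{k}\<close>,
  \<open>{k<..n}\<close> into itself, so \<open>strong_points_Un\<close> applies twice.\<close>

lemma strong_points_split:
  assumes \<alpha>: "\<alpha> permutes {1..<k}" and \<beta>: "\<beta> permutes {k<..n}" and k: "k \<in> {1..n}"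
  shows "strong_points {1..n} (\<alpha> \<circ> \<beta>)
    = strong_points {1..<k} \<alpha> \<union> insert k (strong_points {k<..n} \<beta>)"
proof -
  have X: "{1..n} = {1..<k} \<union> {k} \<union> {k<..n}"
    using k by auto
  have lo: "(\<alpha> \<circ> \<beta>) x = \<alpha> x" "\<alpha> x \<in> {1..<k}" if "x \<in> {1..<k}" for x
    using that \<alpha> \<beta> by (simp_all only: permutes_in_image) (simp add: permutes_not_in[OF \<beta>])
  have hi: "(\<alpha> \<circ> \<beta>) x = \<beta> x" "\<beta> x \<in> {k<..n}" if "x \<in> {k<..n}" for x
  proof -
    show "\<beta> x \<in> {k<..n}" using that \<beta> by (simp only: permutes_in_image)
    then show "(\<alpha> \<circ> \<beta>) x = \<beta> x" by (simp add: permutes_not_in[OF \<alpha>])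
  qed
  have mid: "(\<alpha> \<circ> \<beta>) k = k"
    by (simp add: permutes_not_in[OF \<alpha>] permutes_not_in[OF \<beta>])
  have "strong_points {1..n} (\<alpha> \<circ> \<beta>) = strong_points {1..<k} (\<alpha> \<circ> \<beta>)
      \<union> strong_points ({k} \<union> {k<..n}) (\<alpha> \<circ> \<beta>)"
    unfolding X Un_assoc
    by (rule strong_points_Un) (use lo hi mid in \<open>fastforce simp del: o_apply\<close>)
  also have "strong_points ({k} \<union> {k<..n}) (\<alpha> \<circ> \<beta>)
      = strong_points {k} (\<alpha> \<circ> \<beta>) \<union> strong_points {k<..n} (\<alpha> \<circ> \<beta>)"
    by (rule strong_points_Un) (use hi mid in \<open>fastforce simp del: o_apply\<close>)
  also have "strong_points {k} (\<alpha> \<circ> \<beta>) = {k}"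
    by (auto simp: strong_points_def)
  also have "strong_points {1..<k} (\<alpha> \<circ> \<beta>) = strong_points {1..<k} \<alpha>"
    using lo(1) by (rule strong_points_cong)
  also have "strong_points {k<..n} (\<alpha> \<circ> \<beta>) = strong_points {k<..n} \<beta>"
    using hi(1) by (rule strong_points_cong)
  finally show ?thesis by (simp only: insert_is_Un[symmetric])
qed

text \<open>By pigeonhole: the \<open>k - 1\<close> smaller points map injectively below
  \<open>\<tau> k\<close>, which gives \<open>k \<le> \<tau> k\<close>; the \<open>n - k\<close>
  larger ones map above it, which gives \<open>\<tau> k \<le> k\<close>.\<close>

lemma strong_point_fixed:
  assumes \<tau>: "\<tau> permutes {1..n}" and k: "k \<in> strong_points {1..n} \<tau>"
  shows "\<tau> k = k"
proof -
  have mem: "\<tau> x \<in> {1..n} \<longleftrightarrow> x \<in> {1..n}" for x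
    using \<tau> by (rule permutes_in_image)
  have inj: "inj_on \<tau> A" for A
    using permutes_inj[OF \<tau>] by (rule inj_on_subset) simp
  have kn: "k \<in> {1..n}"
    using k strong_points_subset by blast
  have "\<tau> ` {1..<k} \<subseteq> {1..<\<tau> k}" "\<tau> ` {k<..n} \<subseteq> {\<tau> k<..n}"
    using k mem by (fastforce simp: strong_points_def)+
  then have "card {1..<k} \<le> card {1..<\<tau> k}" "card {k<..n} \<le> card {\<tau> k<..n}"
    using inj by (metis card_inj_on_le finite_atLeastLessThan finite_greaterThanAtMost)+
  then show ?thesis
    \<comment> \<open>The bound \<open>\<tau> k \<le> n\<close> is needed because
      \<open>n - \<tau> k\<close> is a truncated difference.\<close>
    using kn mem[of k] by auto
qed

lemma strong_point_decompose:
  assumes \<tau>: "\<tau> permutes {1..n}" and k: "k \<in> strong_points {1..n} \<tau>"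
  obtains \<alpha> \<beta> where "\<alpha> permutes {1..<k}" "\<beta> permutes {k<..n}" "\<tau> = \<alpha> \<circ> \<beta>"
proof -
  have fixed: "\<tau> k = k"
    using \<tau> k by (rule strong_point_fixed)
  have mem: "\<tau> x \<in> {1..n} \<longleftrightarrow> x \<in> {1..n}" for x
    using \<tau> by (rule permutes_in_image)
  have inj: "inj_on \<tau> A" for A
    using permutes_inj[OF \<tau>] by (rule inj_on_subset) simp
  have kn: "k \<in> {1..n}"
    using k strong_points_subset by blast
  \<comment> \<open>Since \<open>k\<close> is fixed, each side is mapped into itself; an injective
    self-map of a finite set is onto.\<close>
  have lo: "\<tau> ` {1..<k} = {1..<k}"
    using k mem fixed
    by (intro endo_inj_surj inj) (fastforce simp: strong_points_def)+
  have hi: "\<tau> ` {k<..n} = {k<..n}"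
    using k mem fixed
    by (intro endo_inj_surj inj) (fastforce simp: strong_points_def)+
  define \<alpha> where "\<alpha> x = (if x \<in> {1..<k} then \<tau> x else x)" for x
  define \<beta> where "\<beta> x = (if x \<in> {k<..n} then \<tau> x else x)" for x
  have "bij_betw \<alpha> {1..<k} {1..<k}"
    using bij_betw_imageI[OF inj lo] by (rule bij_betw_cong[THEN iffD1, rotated]) (simp add: \<alpha>_def)
  then have "\<alpha> permutes {1..<k}"
    by (rule bij_imp_permutes) (auto simp: \<alpha>_def)
  moreover have "bij_betw \<beta> {k<..n} {k<..n}"
    using bij_betw_imageI[OF inj hi] by (rule bij_betw_cong[THEN iffD1, rotated]) (simp add: \<beta>_def)
  then have "\<beta> permutes {k<..n}"
    by (rule bij_imp_permutes) (auto simp: \<beta>_def)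
  moreover have "\<tau> = \<alpha> \<circ> \<beta>"
  proof
    fix x
    \<comment> \<open>For \<open>x\<close> above \<open>k\<close> the value
      \<open>\<beta> x = \<tau> x\<close> stays above \<open>k\<close>, where
      \<open>\<alpha>\<close> is the identity.\<close>
    have "\<tau> x \<in> {k<..n}" if "x \<in> {k<..n}"
      using hi that by blast
    moreover have "\<tau> x = x" if "x \<notin> {1..n}"
      using \<tau> that by (rule permutes_not_in)
    ultimately show "\<tau> x = (\<alpha> \<circ> \<beta>) x"
      using fixed by (cases x k rule: linorder_cases) (auto simp: \<alpha>_def \<beta>_def)
  qed
  ultimately show ?thesis
    by (rule that)
qed

text \<open>Composition is a bijection from pairs \<open>(\<alpha>, \<beta>)\<close> onto the
  permutations counted. That \<open>k\<close> is least means that \<open>\<alpha>\<close> has no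
  strong point; \<open>k\<close> itself accounts for the successor, which leaves \<open>t\<close>
  strong points to \<open>\<beta>\<close>.\<close>

lemma card_strong_perms_least:
  assumes k: "k \<in> {1..n}"
  shows "card {\<tau> \<in> strong_perms {1..n} (Suc t).
      k \<in> strong_points {1..n} \<tau> \<and> strong_points {1..n} \<tau> \<inter> {1..<k} = {}}
    = card (strong_perms {1..<k} 0) * card (strong_perms {k<..n} t)"
    (is "card ?F = card ?A * card ?B")
proof -
  let ?c = "\<lambda>(\<alpha>, \<beta>). \<alpha> \<circ> \<beta> :: nat \<Rightarrow> nat"
  have finL: "finite (strong_points {1..<k} \<alpha>)" for \<alpha>
    by (rule finite_subset[OF strong_points_subset]) simp
  have finR: "finite (strong_points {k<..n} \<beta>)" for \<beta>
    by (rule finite_subset[OF strong_points_subset]) simp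
  have iff: "\<alpha> \<circ> \<beta> \<in> ?F \<longleftrightarrow> \<alpha> \<in> ?A \<and> \<beta> \<in> ?B"
    if \<alpha>: "\<alpha> permutes {1..<k}" and \<beta>: "\<beta> permutes {k<..n}" for \<alpha> \<beta>
  proof -
    have perm: "\<alpha> \<circ> \<beta> permutes {1..n}"
      using \<alpha> \<beta> k by (intro permutes_compose) (auto elim!: permutes_subset)
    have R: "strong_points {k<..n} \<beta> \<subseteq> {k<..n}" and L: "strong_points {1..<k} \<alpha> \<subseteq> {1..<k}"
      by (rule strong_points_subset)+
    have "strong_points {1..n} (\<alpha> \<circ> \<beta>) \<inter> {1..<k} = strong_points {1..<k} \<alpha>"
      using strong_points_split[OF \<alpha> \<beta> k] L R by auto
    moreover have "card (insert k (strong_points {k<..n} \<beta>)) = Suc (card (strong_points {k<..n} \<beta>))"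
      using R finR by (subst card_insert_disjoint) auto
    ultimately show ?thesis
      using perm \<alpha> \<beta> finL[of \<alpha>] strong_points_split[OF \<alpha> \<beta> k] by (auto simp: strong_perms_def)
  qed
  have "?F = ?c ` (?A \<times> ?B)"
  proof (intro subset_antisym subsetI)
    fix \<tau> assume \<tau>: "\<tau> \<in> ?F"
    then have "\<tau> permutes {1..n}" "k \<in> strong_points {1..n} \<tau>"
      by (auto simp: strong_perms_def)
    then obtain \<alpha> \<beta> where "\<alpha> permutes {1..<k}" "\<beta> permutes {k<..n}" "\<tau> = \<alpha> \<circ> \<beta>"
      by (rule strong_point_decompose)
    then show "\<tau> \<in> ?c ` (?A \<times> ?B)"
      using iff \<tau> by (auto simp: image_iff)
  next
    fix \<tau> assume "\<tau> \<in> ?c ` (?A \<times> ?B)"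
    then obtain \<alpha> \<beta> where "\<alpha> \<in> ?A" "\<beta> \<in> ?B" "\<tau> = \<alpha> \<circ> \<beta>"
      by auto
    then show "\<tau> \<in> ?F"
      using iff[of \<alpha> \<beta>] by (simp add: strong_perms_def)
  qed
  moreover have "inj_on ?c (?A \<times> ?B)"
  proof (rule inj_onI, clarify)
    fix \<alpha> \<beta> \<alpha>' \<beta>'
    assume "\<alpha> \<in> ?A" "\<beta> \<in> ?B" "\<alpha>' \<in> ?A" "\<beta>' \<in> ?B" and eq: "\<alpha> \<circ> \<beta> = \<alpha>' \<circ> \<beta>'"
    then have p: "\<alpha> permutes {1..<k}" "\<beta> permutes {k<..n}" "\<alpha>' permutes {1..<k}" "\<beta>' permutes {k<..n}"
      by (auto simp: strong_perms_def)
    \<comment> \<open>The composition determines both factors: it agrees with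
      \<open>\<alpha>\<close> below \<open>k\<close> and with \<open>\<beta>\<close> from
      \<open>k\<close> on, and elsewhere each factor is the identity.\<close>
    have val: "(\<alpha> \<circ> \<beta>) x = (if x < k then \<alpha> x else \<beta> x)"
      if "\<alpha> permutes {1..<k}" "\<beta> permutes {k<..n}" for \<alpha> \<beta> :: "nat \<Rightarrow> nat" and x
    proof (cases "x < k")
      case True
      then show ?thesis using permutes_not_in[OF that(2)] by simp
    next
      case False
      then have "\<not> \<beta> x < k"
        using permutes_in_image[OF that(2), of x] permutes_not_in[OF that(2), of x] by force
      then show ?thesis using permutes_not_in[OF that(1)] False by simp
    qed
    have "\<alpha> x = \<alpha>' x \<and> \<beta> x = \<beta>' x" for x
      using fun_cong[OF eq, of x] val[OF p(1,2), of x] val[OF p(3,4), of x]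
        p[THEN permutes_not_in, of x] by (cases "x < k") auto
    then show "\<alpha> = \<alpha>' \<and> \<beta> = \<beta>'" by auto
  qed
  ultimately show ?thesis
    by (simp add: card_image card_cartesian_product)
qed

text \<open>This removes the summands with \<open>k > n - t + 1\<close> from the recurrence.\<close>

lemma f_count_1_eq_0:
  assumes "n < t"
  shows "f_count n 1 t = 0"
proof -
  have "card (strong_points {1..n} \<tau>) \<le> n" for \<tau>
    using card_mono[OF _ strong_points_subset, of "{1..n}" \<tau>] by simp
  then have "strong_perms {1..n} t = {}"
    using assms by (auto simp: strong_perms_def not_le[symmetric])
  then show ?thesis by (simp add: f_count_1_eq[simplified])
qed

section \<open>Summation over the least strong point\<close>

theorem theorem2:
  fixes n t :: nat
  assumes "n \<ge> 1" and "1 \<le> t" and "t \<le> n"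
  shows "f_count n 1 t = (\<Sum>k = 1..n - t + 1. f_count (n - k) 1 (t - 1) * f_count (k - 1) 1 0)"
proof -
  obtain s where t: "t = Suc s"
    using assms(2) by (cases t) auto
  let ?S = "strong_points {1..n}"
  let ?F = "\<lambda>k. {\<tau> \<in> strong_perms {1..n} t. k \<in> ?S \<tau> \<and> ?S \<tau> \<inter> {1..<k} = {}}"
  have F: "card (?F k) = f_count (n - k) 1 (t - 1) * f_count (k - 1) 1 0" if k: "k \<in> {1..n}" for k
  proof -
    \<comment> \<open>The shift by \<open>k\<close> identifies the upper side with
      \<open>{1..n - k}\<close> and preserves order.\<close>
    have "(\<lambda>x. x + k) ` {1..n - k} = {1 + k..n - k + k}"
      by (rule image_add_atLeastAtMost')
    also have "\<dots> = {k<..n}" using k by auto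
    finally have "bij_betw (\<lambda>x. x + k) {1..n - k} {k<..n}"
      by (auto simp: bij_betw_def)
    then have "card (strong_perms {1..n - k} s) = card (strong_perms {k<..n} s)"
      by (rule card_strong_perms_order_iso) (auto simp: strict_mono_on_def)
    moreover have "{1..<k} = {1..k - 1}" using k by auto
    ultimately show ?thesis
      unfolding t card_strong_perms_least[OF k] f_count_1_eq by simp
  qed
  \<comment> \<open>A least strong point exists because \<open>t\<close> is positive.\<close>
  have "strong_perms {1..n} t = (\<Union>k\<in>{1..n}. ?F k)"
  proof (intro subset_antisym subsetI)
    fix \<tau> assume \<tau>: "\<tau> \<in> strong_perms {1..n} t"
    then have "card (?S \<tau>) \<noteq> 0" by (simp add: strong_perms_def t)
    then obtain v where "v \<in> ?S \<tau>" by fastforce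
    then have "(LEAST k. k \<in> ?S \<tau>) \<in> ?S \<tau>" by (rule LeastI)
    moreover have "?S \<tau> \<inter> {1..<LEAST k. k \<in> ?S \<tau>} = {}"
      using not_less_Least by fastforce
    ultimately show "\<tau> \<in> (\<Union>k\<in>{1..n}. ?F k)"
      using \<tau> strong_points_subset by blast
  qed auto
  then have "f_count n 1 t = card (\<Union>k\<in>{1..n}. ?F k)"
    by (simp only: f_count_1_eq)
  also have "\<dots> = (\<Sum>k\<in>{1..n}. card (?F k))"
  proof (rule card_UN_disjoint)
    show "\<forall>k\<in>{1..n}. finite (?F k)"
      by (auto intro!: finite_subset[OF _ finite_permutations[of "{1..n}"]] simp: strong_perms_def)
    \<comment> \<open>A strong point \<open>j < k\<close> would lie in \<open>{1..<k}\<close>, where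
      a member of \<open>?F k\<close> has none.\<close>
    have "?F j \<inter> ?F k = {}" if "j \<in> {1..n}" "j < k" for j k
      using that by auto
    then show "\<forall>j\<in>{1..n}. \<forall>k\<in>{1..n}. j \<noteq> k \<longrightarrow> ?F j \<inter> ?F k = {}"
      by (metis (no_types, lifting) Int_commute nat_neq_iff)
  qed simp
  also have "\<dots> = (\<Sum>k = 1..n. f_count (n - k) 1 (t - 1) * f_count (k - 1) 1 0)"
    using F by (rule sum.cong[OF refl])
  also have "\<dots> = (\<Sum>k = 1..n - t + 1. f_count (n - k) 1 (t - 1) * f_count (k - 1) 1 0)"
  proof (rule sum.mono_neutral_right)
    show "\<forall>k\<in>{1..n} - {1..n - t + 1}. f_count (n - k) 1 (t - 1) * f_count (k - 1) 1 0 = 0"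
    proof
      fix k assume "k \<in> {1..n} - {1..n - t + 1}"
      then have "n - k < t - 1" using assms by auto
      then show "f_count (n - k) 1 (t - 1) * f_count (k - 1) 1 0 = 0"
        by (simp only: f_count_1_eq_0 mult_zero_left)
    qed
  qed (use assms in auto)
  finally show ?thesis .
qed

end
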